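(* Let $f:\mathbb{R}^n\to\mathbb{R}$ be twice continuously differentiable, with gradient $g$ and Hessian $H$. Let $x^*\in\mathbb{R}^n$ be a minimizer for $f$, and assume that $H(x^* )$ is nonsingular. Let $H$ be Lipschitz continuous with Lipschitz constant $L_H$ in an open neighborhood $\Omega$ of $x^*$. Let $\{\widehat{x}_i\}$ be the sequence generated by mixed precision Newton's method under the error model given in the context. If, at some iteration $i$, $$\nu_i:=\epsilon_i^H\,\kappa(H(\widehat{x}_i))<1,\qquad (1)$$ then $$\|\widehat{x}_{i+1}-x^*\|\le \alpha_i\|\widehat{x}_i-x^*\|^2+\beta_i\|\widehat{x}_i-x^*\|+\gamma_i,\qquad (2)$$ where $$\alpha_i:=\frac{1+\epsilon_i}{2(1-\nu_i)}L_H\|H(\widehat{x}_i)^{-1}\|,\qquad \beta_i:=\frac{\epsilon_i^H+\epsilon_i}{1-\nu_i}\kappa(H(\widehat{x}_i))+\epsilon_i,$$ $$\gamma_i:=\frac{1+\epsilon_i}{1-\nu_i}\epsilon_i^g\|H(\widehat{x}_i)^{-1}\|+\epsilon_i\|x^*\|.$$ Moreover, if (1) holds for all $i$ and $$\theta_i:=\alpha_i\|\widehat{x}_i-x^*\|+\beta_i<\theta_{\max}$$ for $\theta_{\max}\in[0,1)$, then there exists $\rho>0$ such that if $\widehat{x}_0\in B_\rho(x^* )$, the sequence $\{\widehat{x}_i\}$ is well defined and satisfies (2) for all $i$ until $$\|\widehat{x}_i-x^*\|<\frac{\gamma_i}{1-\theta_{\max}}.$$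
   Context: $\|\cdot\|$ denotes any vector norm and the corresponding operator norm; $\kappa(A)=\|A\|\,\|A^{-1}\|$ is the condition number of a matrix $A$; $B_\rho(x)=\{y\in\mathbb{R}^n:\|y-x\|<\rho\}$. A function $\varphi$ is Lipschitz continuous in an open set $\Omega\subseteq\mathbb{R}^n$ with Lipschitz constant $L\ge 0$ if $\|\varphi(v)-\varphi(w)\|\le L\|v-w\|$ for all $v,w\in\Omega$. Error model (mixed precision Newton's method). At each iteration $i$, the step satisfies $$\widehat{d}_i:=-\big(H(\widehat{x}_i)+E_i^H\big)^{-1}\big(g(\widehat{x}_i)+e_i^g\big),\qquad \widehat{x}_{i+1}=\widehat{x}_i+\widehat{d}_i+e_i^+,$$ $$\|e_i^g\|\le\epsilon_i^g,\qquad \|E_i^H\|\le\epsilon_i^H\|H(\widehat{x}_i)\|,\qquad \|e_i^+\|\le\epsilon_i\big(\|\widehat{x}_i\|+\|\widehat{d}_i\|\big),$$ where $e_i^g,e_i^+\in\mathbb{R}^n$ and $E_i^H\in\mathbb{R}^{n\times n}$ are the gradient, update and Hessian errors, and $\epsilon_i^g,\epsilon_i,\epsilon_i^H$ are the corresponding error levels. The sequence being well defined means that the matrices $H(\widehat{x}_i)+E_i^H$ are invertible.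
   Formalization: In the first part, bound (2) is proved under the added assumption that the segment from x* to the iterate x_i lies in Ω; without it the claim is false, since the Lipschitz condition on H says nothing outside Ω. *)

theory Defs
  imports "HOL-Analysis.Analysis"
begin

text \<open>
  The norm on \<open>real ^ 'n\<close> is arbitrary, so it is an explicit function \<open>N\<close>; the class
  operations \<open>norm\<close>, \<open>dist\<close>, \<open>onorm\<close>, \<open>ball\<close> would fix the Euclidean norm. Derivatives, continuity and
  open sets do not depend on the norm in finite dimension, and the library notions are used for them.
\<close>

definition vector_norm :: "(real ^ 'n \<Rightarrow> real) \<Rightarrow> bool" where
  "vector_norm N \<longleftrightarrow>
     (\<forall>x. 0 \<le> N x) \<and> (\<forall>x. N x = 0 \<longleftrightarrow> x = 0) \<and>
     (\<forall>c x. N (c *\<^sub>R x) = \<bar>c\<bar> * N x) \<and> (\<forall>x y. N (x + y) \<le> N x + N y)"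

text \<open>As in \<open>onorm\<close>, the point \<open>x = 0\<close> contributes \<open>0 / 0 = 0\<close> and is harmless.\<close>

definition op_norm :: "(real ^ 'n \<Rightarrow> real) \<Rightarrow> real ^ 'n ^ 'n \<Rightarrow> real" where
  "op_norm N A = (SUP x. N (A *v x) / N x)"

definition cond_number :: "(real ^ 'n \<Rightarrow> real) \<Rightarrow> real ^ 'n ^ 'n \<Rightarrow> real" where
  "cond_number N A = op_norm N A * op_norm N (matrix_inv A)"

definition norm_ball :: "(real ^ 'n \<Rightarrow> real) \<Rightarrow> real \<Rightarrow> real ^ 'n \<Rightarrow> (real ^ 'n) set" where
  "norm_ball N \<rho> x = {y. N (y - x) < \<rho>}"

definition lipschitz_matrix_fun ::
  "(real ^ 'n \<Rightarrow> real) \<Rightarrow> real \<Rightarrow> (real ^ 'n) set \<Rightarrow> (real ^ 'n \<Rightarrow> real ^ 'n ^ 'n) \<Rightarrow> bool" where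
  "lipschitz_matrix_fun N L \<Omega> F \<longleftrightarrow>
     0 \<le> L \<and> (\<forall>v\<in>\<Omega>. \<forall>w\<in>\<Omega>. op_norm N (F v - F w) \<le> L * N (v - w))"

definition C2_with_gradient_hessian ::
  "(real ^ 'n \<Rightarrow> real) \<Rightarrow> (real ^ 'n \<Rightarrow> real ^ 'n) \<Rightarrow> (real ^ 'n \<Rightarrow> real ^ 'n ^ 'n) \<Rightarrow> bool" where
  "C2_with_gradient_hessian f g H \<longleftrightarrow>
     (\<forall>x. GDERIV f x :> g x) \<and>
     (\<forall>x. (g has_derivative (\<lambda>h. H x *v h)) (at x)) \<and>
     continuous_on UNIV H"

definition local_minimizer :: "(real ^ 'n \<Rightarrow> real) \<Rightarrow> real ^ 'n \<Rightarrow> bool" where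
  "local_minimizer f z \<longleftrightarrow> (\<forall>\<^sub>F y in nhds z. f z \<le> f y)"

text \<open>
  The error levels are \<open>\<epsilon>g\<close>, \<open>\<epsilon>H\<close>, \<open>\<epsilon>\<close>; the errors are \<open>eg\<close>, \<open>EH\<close>, \<open>ep\<close>; the computed directions
  are \<open>d\<close> and the iterates \<open>x\<close>. Since \<open>matrix_inv\<close> is unspecified on singular matrices, the
  formulas for \<open>d i\<close> and \<open>x (Suc i)\<close> are imposed only where the inverse exists: \<open>x\<close> is a
  sequence generated by the method exactly as long as the matrices \<open>H (x i) + EH i\<close> are invertible.
\<close>

definition mixed_precision_newton ::
  "(real ^ 'n \<Rightarrow> real) \<Rightarrow> (real ^ 'n \<Rightarrow> real ^ 'n) \<Rightarrow> (real ^ 'n \<Rightarrow> real ^ 'n ^ 'n) \<Rightarrow>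
   (nat \<Rightarrow> real) \<Rightarrow> (nat \<Rightarrow> real) \<Rightarrow> (nat \<Rightarrow> real) \<Rightarrow>
   (nat \<Rightarrow> real ^ 'n) \<Rightarrow> (nat \<Rightarrow> real ^ 'n ^ 'n) \<Rightarrow> (nat \<Rightarrow> real ^ 'n) \<Rightarrow>
   (nat \<Rightarrow> real ^ 'n) \<Rightarrow> (nat \<Rightarrow> real ^ 'n) \<Rightarrow> bool" where
  "mixed_precision_newton N g H \<epsilon>g \<epsilon>H \<epsilon> eg EH ep d x \<longleftrightarrow>
     (\<forall>i. 0 \<le> \<epsilon>g i \<and> 0 \<le> \<epsilon>H i \<and> 0 \<le> \<epsilon> i \<and>
          N (eg i) \<le> \<epsilon>g i \<and>
          op_norm N (EH i) \<le> \<epsilon>H i * op_norm N (H (x i)) \<and>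
          (invertible (H (x i) + EH i) \<longrightarrow>
             d i = - (matrix_inv (H (x i) + EH i) *v (g (x i) + eg i)) \<and>
             x (Suc i) = x i + d i + ep i \<and>
             N (ep i) \<le> \<epsilon> i * (N (x i) + N (d i))))"

text \<open>
  In the following quantities \<open>A\<close> stands for the Hessian at the current iterate; they are meaningful
  for invertible \<open>A\<close>.
\<close>

definition nu :: "(real ^ 'n \<Rightarrow> real) \<Rightarrow> real \<Rightarrow> real ^ 'n ^ 'n \<Rightarrow> real" where
  "nu N \<epsilon>H A = \<epsilon>H * cond_number N A"

definition alpha :: "(real ^ 'n \<Rightarrow> real) \<Rightarrow> real \<Rightarrow> real \<Rightarrow> real \<Rightarrow> real ^ 'n ^ 'n \<Rightarrow> real" where
  "alpha N L \<epsilon>H \<epsilon> A =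
     (1 + \<epsilon>) / (2 * (1 - nu N \<epsilon>H A)) * L * op_norm N (matrix_inv A)"

definition beta :: "(real ^ 'n \<Rightarrow> real) \<Rightarrow> real \<Rightarrow> real \<Rightarrow> real ^ 'n ^ 'n \<Rightarrow> real" where
  "beta N \<epsilon>H \<epsilon> A = (\<epsilon>H + \<epsilon>) / (1 - nu N \<epsilon>H A) * cond_number N A + \<epsilon>"

definition gamma ::
  "(real ^ 'n \<Rightarrow> real) \<Rightarrow> real ^ 'n \<Rightarrow> real \<Rightarrow> real \<Rightarrow> real \<Rightarrow> real ^ 'n ^ 'n \<Rightarrow> real" where
  "gamma N xstar \<epsilon>g \<epsilon>H \<epsilon> A =
     (1 + \<epsilon>) / (1 - nu N \<epsilon>H A) * \<epsilon>g * op_norm N (matrix_inv A) + \<epsilon> * N xstar"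

definition theta ::
  "(real ^ 'n \<Rightarrow> real) \<Rightarrow> real \<Rightarrow> real ^ 'n \<Rightarrow> real \<Rightarrow> real \<Rightarrow> real ^ 'n ^ 'n \<Rightarrow> real ^ 'n \<Rightarrow> real" where
  "theta N L xstar \<epsilon>H \<epsilon> A x = alpha N L \<epsilon>H \<epsilon> A * N (x - xstar) + beta N \<epsilon>H \<epsilon> A"

end

theory Submission
  imports Defs
begin

text \<open>
  Write \<open>e = x - x\<^sup>*\<close> for the current error, \<open>A = H x\<close>, and \<open>M = A + E\<close> for the matrix that
  is actually inverted. Two facts carry the estimate.

  First, \<open>M\<close> is a relatively small perturbation of \<open>A\<close>: if \<open>\<nu> = \<epsilon>\<^sub>H \<kappa>(A) < 1\<close>, then \<open>M\<close> is
  invertible and \<open>\<parallel>M\<^sup>-\<^sup>1\<parallel> \<le> \<parallel>A\<^sup>-\<^sup>1\<parallel> / (1 - \<nu>)\<close> (\<open>perturbed_inverse\<close>). Second, the gradient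
  vanishes at the minimizer, so Taylor's formula with the Lipschitz Hessian bounds
  \<open>r = A e - g x\<close> by \<open>L/2 \<parallel>e\<parallel>\<^sup>2\<close> (\<open>lipschitz_derivative_remainder\<close>). Substituting
  \<open>g x = A e - r\<close> into the step \<open>d = - M\<^sup>-\<^sup>1 (g x + e\<^sub>g)\<close> gives
  \<open>e + d = M\<^sup>-\<^sup>1 (E e + r - e\<^sub>g)\<close>, where the three summands account for the linear, the quadratic
  and the constant part of the bound. The update error is at most
  \<open>\<epsilon> (\<parallel>x\<parallel> + \<parallel>d\<parallel>) \<le> \<epsilon> (2 \<parallel>e\<parallel> + \<parallel>x\<^sup>*\<parallel> + \<parallel>e + d\<parallel>)\<close>; the resulting
  coefficients are at most \<open>\<alpha>, \<beta>, \<gamma>\<close> because \<open>\<kappa>(A) \<ge> 1\<close> (\<open>inexact_newton_step\<close>).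

  For the local statement, \<open>\<rho>\<close> is chosen such that the \<open>\<rho>\<close>-ball of \<open>N\<close> around \<open>x\<^sup>*\<close> lies in \<open>\<Omega>\<close> and
  has only invertible Hessians; the ball is convex, so the segments on which Taylor's formula
  is used stay in \<open>\<Omega>\<close>. As long as \<open>\<gamma> \<le> (1 - \<theta>\<^sub>m\<^sub>a\<^sub>x) \<parallel>e\<parallel>\<close>, the one-step bound
  \<open>\<theta> \<parallel>e\<parallel> + \<gamma>\<close> is at most \<open>\<parallel>e\<parallel>\<close>, so the iterates never leave that ball.

  Passing from the Euclidean norm to an arbitrary \<open>N\<close> by equivalence of norms would spoil the
  constant in the Taylor bound. The mean value argument therefore goes through a functional \<open>y \<mapsto> a \<bullet> y\<close>
  that is dominated by \<open>N\<close> and attains it at a given vector (\<open>norming_functional\<close>).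
\<close>

section \<open>Invertible matrices\<close>

lemma matrix_inv_mult:
  fixes A :: "real ^ 'n ^ 'n"
  assumes "invertible A"
  shows "matrix_inv A *v (A *v v) = v" "A *v (matrix_inv A *v v) = v"
proof -
  have "A ** matrix_inv A = mat 1 \<and> matrix_inv A ** A = mat 1"
    using assms unfolding invertible_def matrix_inv_def by (rule someI_ex)
  then show "matrix_inv A *v (A *v v) = v" "A *v (matrix_inv A *v v) = v"
    by (simp_all add: matrix_vector_mul_assoc)
qed

lemma open_invertible:
  fixes H :: "'a::topological_space \<Rightarrow> real ^ 'n ^ 'n"
  assumes "continuous_on UNIV H"
  shows "open {y. invertible (H y)}"
proof -
  have "continuous_on UNIV (\<lambda>y. det (H y))"
    unfolding det_def by (intro continuous_intros assms)
  then have "open {y. det (H y) \<noteq> 0}"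
    by (intro open_Collect_neq continuous_on_const)
  then show ?thesis by (simp add: invertible_det_nz)
qed

section \<open>Arbitrary norms and their operator norms\<close>

context
  fixes N :: "real ^ 'n \<Rightarrow> real"
  assumes N: "vector_norm N"
begin

lemma vector_norm_nonneg: "0 \<le> N x"
  using N by (simp add: vector_norm_def)

lemma vector_norm_eq_0: "N x = 0 \<longleftrightarrow> x = 0"
  using N by (simp add: vector_norm_def)

lemma vector_norm_scaleR: "N (c *\<^sub>R x) = \<bar>c\<bar> * N x"
  using N by (simp add: vector_norm_def)

lemma vector_norm_triangle: "N (x + y) \<le> N x + N y"
  using N by (simp add: vector_norm_def)

lemma vector_norm_minus: "N (- x) = N x"
  using vector_norm_scaleR[of "-1" x] by simp

lemma vector_norm_triangle_diff: "N (x - y) \<le> N x + N y"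
  using vector_norm_triangle[of x "- y"] by (simp add: vector_norm_minus)

lemma vector_norm_pos: "x \<noteq> 0 \<Longrightarrow> 0 < N x"
  using vector_norm_nonneg[of x] vector_norm_eq_0[of x] by linarith

lemma vector_norm_convex: "convex_on UNIV N"
proof (rule convex_onI)
  fix t :: real and x y
  assume "0 < t" "t < 1"
  then show "N ((1 - t) *\<^sub>R x + t *\<^sub>R y) \<le> (1 - t) * N x + t * N y"
    using vector_norm_triangle[of "(1 - t) *\<^sub>R x" "t *\<^sub>R y"] by (simp add: vector_norm_scaleR)
qed simp

lemma vector_norm_equivalent_norm:
  obtains c C where "0 < c" "\<And>x. c * norm x \<le> N x" "0 \<le> C" "\<And>x. N x \<le> C * norm x"
proof -
  let ?S = "sphere (0 :: real ^ 'n) 1"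
  have cont: "continuous_on ?S N"
    using convex_on_continuous[OF open_UNIV vector_norm_convex] continuous_on_subset by blast
  have ne: "?S \<noteq> {}" by simp
  obtain u where u: "u \<in> ?S" "\<forall>y\<in>?S. N u \<le> N y"
    using continuous_attains_inf[OF compact_sphere ne cont] by blast
  obtain v where v: "v \<in> ?S" "\<forall>y\<in>?S. N y \<le> N v"
    using continuous_attains_sup[OF compact_sphere ne cont] by blast
  have "0 < N u"
    using u(1) by (intro vector_norm_pos) auto
  moreover have "N u * norm x \<le> N x \<and> N x \<le> N v * norm x" for x
  proof (cases "x = 0")
    case True
    then show ?thesis using vector_norm_eq_0[of 0] by simp
  next
    case False
    define s where "s = (1 / norm x) *\<^sub>R x"
    have "s \<in> ?S" using False by (simp add: s_def)
    moreover have "N x = N s * norm x"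
      using False by (simp add: s_def vector_norm_scaleR)
    ultimately show ?thesis using u(2) v(2) by (simp add: mult_right_mono)
  qed
  ultimately show ?thesis using that vector_norm_nonneg by blast
qed

text \<open>
  A supremum of reals is an upper bound only for a bounded set; equivalence with the Euclidean norm
  bounds the quotients.
\<close>

lemma op_norm_bound: "N (A *v v) \<le> op_norm N A * N v"
proof -
  obtain c D where c: "0 < c" "\<And>x. c * norm x \<le> N x" and D: "0 \<le> D" "\<And>x. N x \<le> D * norm x"
    using vector_norm_equivalent_norm by blast
  obtain K where K: "\<And>x. norm (A *v x) \<le> K * norm x" "0 < K"
    using linear_bounded_pos[OF matrix_vector_mul_linear, of A] by blast
  have "bdd_above (range (\<lambda>x. N (A *v x) / N x))"
  proof (rule bdd_aboveI2)
    fix x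
    show "N (A *v x) / N x \<le> D * K / c"
    proof (cases "x = 0")
      case True
      then show ?thesis using D(1) K(2) c(1) vector_norm_eq_0[of 0] by simp
    next
      case False
      have "N (A *v x) \<le> D * (K * norm x)"
        using D(2)[of "A *v x"] mult_left_mono[OF K(1)[of x] D(1)] by linarith
      also have "\<dots> = (D * K / c) * (c * norm x)" using c(1) by simp
      also have "\<dots> \<le> (D * K / c) * N x"
        by (rule mult_left_mono[OF c(2)]) (use D(1) K(2) c(1) in simp)
      finally show ?thesis using vector_norm_pos[OF False] by (simp add: divide_le_eq)
    qed
  qed
  then have "N (A *v v) / N v \<le> op_norm N A"
    unfolding op_norm_def by (rule cSUP_upper2[OF _ UNIV_I order_refl])
  then show ?thesis
    using vector_norm_pos[of v] vector_norm_eq_0[of 0] by (cases "v = 0") (auto simp: divide_le_eq)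
qed

lemma op_norm_nonneg: "0 \<le> op_norm N A"
proof -
  have "0 \<le> op_norm N A * N (axis undefined 1)"
    using op_norm_bound[of A "axis undefined 1"] vector_norm_nonneg by (rule order_trans[rotated])
  then show ?thesis
    using vector_norm_pos[of "axis undefined 1 :: real ^ 'n"] by (simp add: zero_le_mult_iff)
qed

text \<open>
  The supporting functional at \<open>r\<close> of the ball \<open>{y. N y < N r}\<close>, rescaled; this is the
  finite-dimensional Hahn-Banach theorem. It turns estimates of \<open>N\<close> into estimates of real-valued
  functions.
\<close>

lemma norming_functional:
  obtains a where "a \<bullet> r = N r" "\<And>y. a \<bullet> y \<le> N y"
proof (cases "r = 0")
  case True
  then show ?thesis using that[of 0] vector_norm_nonneg vector_norm_eq_0[of 0] by simp
next
  case False
  let ?S = "{y. N y < N r}"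
  note r = vector_norm_pos[OF False]
  have "convex ?S"
  proof (rule convexI)
    fix v w and s t :: real
    assume "v \<in> ?S" "w \<in> ?S" and st: "0 \<le> s" "0 \<le> t" "s + t = 1"
    then show "s *\<^sub>R v + t *\<^sub>R w \<in> ?S"
      using vector_norm_triangle[of "s *\<^sub>R v" "t *\<^sub>R w"] convex_bound_lt[of "N v" "N r" "N w" s t]
      by (simp add: vector_norm_scaleR)
  qed
  moreover have "0 \<in> ?S" using r vector_norm_eq_0[of 0] by simp
  then have "?S \<noteq> {}" by blast
  ultimately obtain a b where a: "a \<noteq> 0" "\<forall>y\<in>?S. a \<bullet> y \<le> b" "b \<le> a \<bullet> r"
    using separating_hyperplane_sets[of ?S "{r}"] by auto
  then have sup: "a \<bullet> y \<le> a \<bullet> r" if "N y < N r" for y using that by force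
  \<comment> \<open>\<open>y\<close> is rescaled to norm \<open>z * N r\<close>, inside the open ball; then \<open>z\<close> tends to \<open>1\<close>.\<close>
  have scaled: "z * (N r / N y * (a \<bullet> y)) \<le> a \<bullet> r" if "0 < z" "z < 1" "y \<noteq> 0" for y z
  proof -
    have "N ((z * (N r / N y)) *\<^sub>R y) < N r"
      using that r vector_norm_pos[of y] by (simp add: vector_norm_scaleR)
    then show ?thesis using sup[of "(z * (N r / N y)) *\<^sub>R y"] by (simp add: mult.assoc)
  qed
  have le: "N r * (a \<bullet> y) \<le> (a \<bullet> r) * N y" if "y \<noteq> 0" for y
  proof -
    have "N r / N y * (a \<bullet> y) \<le> a \<bullet> r"
      by (rule field_le_mult_one_interval) (rule scaled[OF _ _ that])
    then show ?thesis using vector_norm_pos[OF that] by (simp add: field_simps)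
  qed
  have "0 < N r * (a \<bullet> a)" using r a(1) by simp
  then have pos: "0 < a \<bullet> r"
    using le[OF a(1)] vector_norm_pos[OF a(1)] by (metis less_le_trans zero_less_mult_pos2)
  show ?thesis
  proof (rule that[of "(N r / (a \<bullet> r)) *\<^sub>R a"])
    show "(N r / (a \<bullet> r)) *\<^sub>R a \<bullet> r = N r" using pos by simp
    show "(N r / (a \<bullet> r)) *\<^sub>R a \<bullet> y \<le> N y" for y
      using le[of y] pos vector_norm_eq_0[of 0] by (cases "y = 0") (auto simp: field_simps)
  qed
qed

section \<open>Condition numbers and perturbed inverses\<close>

lemma cond_number_ge_1:
  assumes "invertible A"
  shows "1 \<le> cond_number N A"
proof -
  let ?v = "axis undefined 1 :: real ^ 'n"
  have "N ?v = N (matrix_inv A *v (A *v ?v))" by (simp add: matrix_inv_mult[OF assms])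
  also have "\<dots> \<le> op_norm N (matrix_inv A) * N (A *v ?v)" by (rule op_norm_bound)
  also have "\<dots> \<le> op_norm N (matrix_inv A) * (op_norm N A * N ?v)"
    by (intro mult_left_mono op_norm_bound op_norm_nonneg)
  also have "\<dots> = cond_number N A * N ?v" by (simp add: cond_number_def)
  finally show ?thesis using vector_norm_pos[of ?v] by simp
qed

text \<open>
  Writing \<open>v = A\<^sup>-\<^sup>1 ((A + E) v - E v)\<close> bounds \<open>N v\<close> by \<open>\<parallel>A\<^sup>-\<^sup>1\<parallel> N ((A + E) v) + \<nu> N v\<close>. With
  \<open>\<nu> < 1\<close> this gives at once the trivial kernel of \<open>A + E\<close> and the norm of its inverse.
\<close>

lemma perturbed_inverse:
  assumes A: "invertible A" and \<eta>: "op_norm N E \<le> \<eta> * op_norm N A" and \<nu>: "nu N \<eta> A < 1"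
  shows "invertible (A + E)"
    and "N (matrix_inv (A + E) *v w) \<le> op_norm N (matrix_inv A) / (1 - nu N \<eta> A) * N w"
proof -
  let ?K = "op_norm N (matrix_inv A)"
  have coercive: "(1 - nu N \<eta> A) * N v \<le> ?K * N ((A + E) *v v)" for v
  proof -
    let ?u = "(A + E) *v v - E *v v"
    have "N (E *v v) \<le> \<eta> * op_norm N A * N v"
      by (rule order_trans[OF op_norm_bound mult_right_mono[OF \<eta> vector_norm_nonneg]])
    then have u: "N ?u \<le> N ((A + E) *v v) + \<eta> * op_norm N A * N v"
      using vector_norm_triangle_diff[of "(A + E) *v v" "E *v v"] by linarith
    have "v = matrix_inv A *v ?u"
      by (simp add: matrix_inv_mult[OF A] matrix_vector_mult_add_rdistrib)
    then have "N v \<le> ?K * N ?u" by (metis op_norm_bound)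
    also have "\<dots> \<le> ?K * (N ((A + E) *v v) + \<eta> * op_norm N A * N v)"
      by (intro mult_left_mono u op_norm_nonneg)
    finally show ?thesis by (simp add: nu_def cond_number_def algebra_simps)
  qed
  have "v = 0" if "(A + E) *v v = 0" for v
  proof -
    have "(1 - nu N \<eta> A) * N v \<le> 0" using coercive[of v] that vector_norm_eq_0[of 0] by simp
    then show ?thesis
      using \<nu> vector_norm_pos[of v] by (cases "v = 0") (auto simp: mult_le_0_iff)
  qed
  then show inv: "invertible (A + E)"
    by (metis invertible_left_inverse matrix_left_invertible_ker)
  show "N (matrix_inv (A + E) *v w) \<le> ?K / (1 - nu N \<eta> A) * N w"
    using coercive[of "matrix_inv (A + E) *v w"] \<nu>
    by (simp add: matrix_inv_mult[OF inv] field_simps)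
qed

section \<open>The Taylor remainder\<close>

text \<open>
  Along the segment, \<open>t \<mapsto> t H(y) h - g(z + t h)\<close> with \<open>h = y - z\<close> has the derivative
  \<open>(H(y) - H(z + t h)) h\<close>, of size at most \<open>L (1 - t) N(h)\<^sup>2\<close>; integrating \<open>1 - t\<close> over the unit
  interval gives the factor \<open>1/2\<close>. A norming functional of the remainder makes this a monotonicity
  argument for a real function.
\<close>

lemma lipschitz_derivative_remainder:
  assumes der: "\<And>x. (g has_derivative (\<lambda>h. H x *v h)) (at x)"
    and lip: "lipschitz_matrix_fun N L \<Omega> H"
    and seg: "closed_segment z y \<subseteq> \<Omega>"
  shows "N (H y *v (y - z) - (g y - g z)) \<le> L / 2 * (N (y - z))\<^sup>2"
proof -
  define h where "h = y - z"
  obtain a where a: "a \<bullet> (H y *v h - (g y - g z)) = N (H y *v h - (g y - g z))" "\<And>y. a \<bullet> y \<le> N y"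
    using norming_functional by blast
  let ?c = "L * (N h)\<^sup>2"
  let ?\<phi> = "\<lambda>t. a \<bullet> (t *\<^sub>R (H y *v h) - g (z + t *\<^sub>R h)) - ?c * (t - t\<^sup>2 / 2)"
  have "?\<phi> 0 \<ge> ?\<phi> 1"
  proof (rule DERIV_nonpos_imp_nonincreasing[of 0 1 ?\<phi>])
    fix t :: real
    assume t: "0 \<le> t" "t \<le> 1"
    let ?w = "z + t *\<^sub>R h"
    have "((\<lambda>t. g (z + t *\<^sub>R h)) has_derivative (\<lambda>s. H ?w *v (s *\<^sub>R h))) (at t)"
      by (rule has_derivative_compose[OF _ der]) (auto intro!: derivative_eq_intros)
    then have "((\<lambda>t. t *\<^sub>R (H y *v h) - g (z + t *\<^sub>R h)) has_derivative
        (\<lambda>s. s *\<^sub>R (H y *v h) - H ?w *v (s *\<^sub>R h))) (at t)"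
      by (intro has_derivative_diff has_derivative_scaleR_left has_derivative_ident)
    then have "((\<lambda>t. a \<bullet> (t *\<^sub>R (H y *v h) - g (z + t *\<^sub>R h))) has_derivative
        (\<lambda>s. a \<bullet> (s *\<^sub>R (H y *v h) - H ?w *v (s *\<^sub>R h)))) (at t)"
      by (rule has_derivative_inner_right)
    then have "((\<lambda>t. a \<bullet> (t *\<^sub>R (H y *v h) - g (z + t *\<^sub>R h))) has_real_derivative
        a \<bullet> ((H y - H ?w) *v h)) (at t)"
      unfolding has_field_derivative_def
      by (rule has_derivative_eq_rhs)
        (auto simp: matrix_vector_mult_scaleR matrix_vector_mult_diff_rdistrib algebra_simps)
    moreover have "((\<lambda>t. ?c * (t - t\<^sup>2 / 2)) has_real_derivative ?c * (1 - t)) (at t)"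
      by (auto intro!: derivative_eq_intros)
    ultimately have deriv: "(?\<phi> has_real_derivative a \<bullet> ((H y - H ?w) *v h) - ?c * (1 - t)) (at t)"
      by (rule DERIV_diff)
    have "?w = (1 - t) *\<^sub>R z + t *\<^sub>R y" by (simp add: h_def algebra_simps)
    then have "?w \<in> \<Omega>" using seg t unfolding closed_segment_def by blast
    moreover have "y \<in> \<Omega>" using seg by auto
    moreover have "y - ?w = (1 - t) *\<^sub>R h" by (simp add: h_def algebra_simps)
    ultimately have "op_norm N (H y - H ?w) \<le> L * ((1 - t) * N h)"
      using lip t unfolding lipschitz_matrix_fun_def
      by (metis abs_of_nonneg diff_ge_0_iff_ge vector_norm_scaleR)
    then have "op_norm N (H y - H ?w) * N h \<le> L * ((1 - t) * N h) * N h"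
      by (intro mult_right_mono vector_norm_nonneg)
    then have "a \<bullet> ((H y - H ?w) *v h) \<le> ?c * (1 - t)"
      using a(2)[of "(H y - H ?w) *v h"] op_norm_bound[of "H y - H ?w" h]
      by (simp add: power2_eq_square mult_ac)
    then show "\<exists>D. (?\<phi> has_real_derivative D) (at t) \<and> D \<le> 0" using deriv by force
  qed simp
  then have "a \<bullet> (H y *v h - g y) \<le> ?c / 2 - a \<bullet> g z" by (simp add: h_def inner_diff_right)
  then show ?thesis using a(1) by (simp add: h_def inner_diff_right)
qed

section \<open>One inexact Newton step\<close>

text \<open>
  The hypothesis \<open>r\<close> is the Taylor remainder at a critical point. In the coefficient of \<open>N (x - z)\<close>
  the direct estimate yields \<open>(1 + \<epsilon>) \<nu> / (1 - \<nu>) + 2 \<epsilon>\<close>; the claim follows from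
  \<open>\<nu> / (1 - \<nu>) + 1 = 1 / (1 - \<nu>) \<le> \<kappa> / (1 - \<nu>)\<close>.
\<close>

lemma inexact_newton_step:
  assumes A: "invertible A"
    and \<nu>: "nu N \<epsilon>H A < 1"
    and E: "op_norm N E \<le> \<epsilon>H * op_norm N A"
    and r: "N (A *v (x - z) - gx) \<le> L / 2 * (N (x - z))\<^sup>2"
    and eg: "N eg \<le> \<epsilon>g"
    and d: "d = - (matrix_inv (A + E) *v (gx + eg))"
    and ep: "N ep \<le> \<epsilon> * (N x + N d)" "0 \<le> \<epsilon>"
  shows "N (x + d + ep - z)
      \<le> alpha N L \<epsilon>H \<epsilon> A * (N (x - z))\<^sup>2 + beta N \<epsilon>H \<epsilon> A * N (x - z) + gamma N z \<epsilon>g \<epsilon>H \<epsilon> A"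
proof -
  define e where "e = x - z"
  define q where "q = A *v e - gx"
  let ?\<nu> = "nu N \<epsilon>H A" and ?\<kappa> = "cond_number N A" and ?K = "op_norm N (matrix_inv A)"
  define m where "m = ?K / (1 - ?\<nu>)"
  have m: "0 \<le> m" using \<nu> op_norm_nonneg[of "matrix_inv A"] by (simp add: m_def)
  note inv = perturbed_inverse(1)[OF A E \<nu>]
  have "matrix_inv (A + E) *v (E *v e + q - eg)
      = matrix_inv (A + E) *v ((A + E) *v e - (gx + eg))"
    by (simp add: q_def matrix_vector_mult_add_rdistrib algebra_simps)
  also have "\<dots> = e + d"
    by (simp add: d matrix_vector_mult_diff_distrib matrix_inv_mult[OF inv])
  finally have ed: "e + d = matrix_inv (A + E) *v (E *v e + q - eg)" ..
  have "N (E *v e) \<le> \<epsilon>H * op_norm N A * N e"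
    by (rule order_trans[OF op_norm_bound mult_right_mono[OF E vector_norm_nonneg]])
  then have "N (E *v e + q - eg) \<le> \<epsilon>H * op_norm N A * N e + L / 2 * (N e)\<^sup>2 + \<epsilon>g"
    using vector_norm_triangle_diff[of "E *v e + q" eg] vector_norm_triangle[of "E *v e" q] r eg
    by (simp add: q_def e_def)
  then have "m * N (E *v e + q - eg) \<le> m * (\<epsilon>H * op_norm N A * N e + L / 2 * (N e)\<^sup>2 + \<epsilon>g)"
    using m by (rule mult_left_mono)
  then have "N (e + d) \<le> m * (\<epsilon>H * op_norm N A * N e + L / 2 * (N e)\<^sup>2 + \<epsilon>g)"
    using perturbed_inverse(2)[OF A E \<nu>, of "E *v e + q - eg"] by (simp add: ed m_def)
  also have "\<dots> = ?\<nu> / (1 - ?\<nu>) * N e + m * (L / 2) * (N e)\<^sup>2 + m * \<epsilon>g"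
    by (simp add: m_def nu_def cond_number_def algebra_simps)
  finally have Ned: "N (e + d) \<le> \<dots>" .
  have "N x \<le> N e + N z" using vector_norm_triangle[of e z] by (simp add: e_def)
  moreover have "N d \<le> N (e + d) + N e" using vector_norm_triangle_diff[of "e + d" e] by simp
  ultimately have "\<epsilon> * (N x + N d) \<le> \<epsilon> * (2 * N e + N z + N (e + d))"
    using ep(2) by (intro mult_left_mono) auto
  moreover have "N (x + d + ep - z) \<le> N (e + d) + N ep"
    using vector_norm_triangle[of "e + d" ep] by (simp add: e_def algebra_simps)
  ultimately have "N (x + d + ep - z) \<le> (1 + \<epsilon>) * N (e + d) + \<epsilon> * (2 * N e + N z)"
    using ep(1) by (simp add: algebra_simps)
  also have "\<dots> \<le> (1 + \<epsilon>) * (?\<nu> / (1 - ?\<nu>) * N e + m * (L / 2) * (N e)\<^sup>2 + m * \<epsilon>g)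
      + \<epsilon> * (2 * N e + N z)"
    using mult_left_mono[OF Ned, of "1 + \<epsilon>"] ep(2) by simp
  also have "\<dots> = (1 + \<epsilon>) * (m * (L / 2)) * (N e)\<^sup>2 + ((1 + \<epsilon>) * (?\<nu> / (1 - ?\<nu>)) + 2 * \<epsilon>) * N e
      + ((1 + \<epsilon>) * (m * \<epsilon>g) + \<epsilon> * N z)"
    by (simp add: algebra_simps)
  also have "(1 + \<epsilon>) * (m * (L / 2)) = alpha N L \<epsilon>H \<epsilon> A"
    using \<nu> by (simp add: alpha_def m_def field_simps)
  also have "(1 + \<epsilon>) * (m * \<epsilon>g) + \<epsilon> * N z = gamma N z \<epsilon>g \<epsilon>H \<epsilon> A"
    by (simp add: gamma_def m_def)
  also have "((1 + \<epsilon>) * (?\<nu> / (1 - ?\<nu>)) + 2 * \<epsilon>) * N e \<le> beta N \<epsilon>H \<epsilon> A * N e"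
  proof (rule mult_right_mono[OF _ vector_norm_nonneg])
    have "?\<nu> / (1 - ?\<nu>) + 1 = 1 / (1 - ?\<nu>)" using \<nu> by (simp add: field_simps)
    also have "\<dots> \<le> ?\<kappa> / (1 - ?\<nu>)"
      using \<nu> cond_number_ge_1[OF A] by (intro divide_right_mono) auto
    finally have "\<epsilon> * (?\<nu> / (1 - ?\<nu>)) + \<epsilon> \<le> \<epsilon> * (?\<kappa> / (1 - ?\<nu>))"
      using mult_left_mono[OF _ ep(2)] by (metis distrib_left mult.right_neutral)
    moreover have "beta N \<epsilon>H \<epsilon> A = ?\<nu> / (1 - ?\<nu>) + \<epsilon> * (?\<kappa> / (1 - ?\<nu>)) + \<epsilon>"
      by (simp add: beta_def nu_def add_divide_distrib distrib_right)
    ultimately show "(1 + \<epsilon>) * (?\<nu> / (1 - ?\<nu>)) + 2 * \<epsilon> \<le> beta N \<epsilon>H \<epsilon> A"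
      unfolding distrib_right mult_1 by linarith
  qed
  finally show ?thesis by (simp add: e_def)
qed

lemma mixed_precision_newton_invertible:
  assumes "mixed_precision_newton N g H \<epsilon>g \<epsilon>H \<epsilon> eg EH ep d x"
    and "invertible (H (x i))" "nu N (\<epsilon>H i) (H (x i)) < 1"
  shows "invertible (H (x i) + EH i)"
  using assms by (intro perturbed_inverse(1)) (auto simp: mixed_precision_newton_def)

lemma mixed_precision_newton_step:
  assumes der: "\<And>x. (g has_derivative (\<lambda>h. H x *v h)) (at x)"
    and lip: "lipschitz_matrix_fun N L \<Omega> H"
    and crit: "g z = 0"
    and newton: "mixed_precision_newton N g H \<epsilon>g \<epsilon>H \<epsilon> eg EH ep d x"
    and inv: "invertible (H (x i))" and \<nu>: "nu N (\<epsilon>H i) (H (x i)) < 1"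
    and seg: "closed_segment z (x i) \<subseteq> \<Omega>"
  shows "N (x (Suc i) - z)
      \<le> alpha N L (\<epsilon>H i) (\<epsilon> i) (H (x i)) * (N (x i - z))\<^sup>2
        + beta N (\<epsilon>H i) (\<epsilon> i) (H (x i)) * N (x i - z)
        + gamma N z (\<epsilon>g i) (\<epsilon>H i) (\<epsilon> i) (H (x i))"
proof -
  have "invertible (H (x i) + EH i)"
    by (rule mixed_precision_newton_invertible[OF newton inv \<nu>])
  then have step: "d i = - (matrix_inv (H (x i) + EH i) *v (g (x i) + eg i))"
      "x (Suc i) = x i + d i + ep i" "N (ep i) \<le> \<epsilon> i * (N (x i) + N (d i))"
    and err: "0 \<le> \<epsilon> i" "N (eg i) \<le> \<epsilon>g i" "op_norm N (EH i) \<le> \<epsilon>H i * op_norm N (H (x i))"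
    using newton by (auto simp: mixed_precision_newton_def)
  have "N (H (x i) *v (x i - z) - g (x i)) \<le> L / 2 * (N (x i - z))\<^sup>2"
    using lipschitz_derivative_remainder[OF der lip seg] by (simp add: crit)
  from inexact_newton_step[OF inv \<nu> err(3) this err(2) step(1) step(3) err(1)]
  show ?thesis by (simp add: step(2))
qed

section \<open>The local statement\<close>

lemma norm_ball_in_open:
  assumes "open S" "z \<in> S"
  obtains \<rho> where "0 < \<rho>" "norm_ball N \<rho> z \<subseteq> S"
proof -
  obtain \<delta> where \<delta>: "0 < \<delta>" "ball z \<delta> \<subseteq> S" using assms openE by blast
  obtain c where c: "0 < c" "\<And>x. c * norm x \<le> N x" using vector_norm_equivalent_norm by metis
  have "y \<in> S" if "N (y - z) < c * \<delta>" for y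
  proof -
    have "c * norm (y - z) < c * \<delta>" using c(2)[of "y - z"] that by linarith
    then have "y \<in> ball z \<delta>" using c(1) by (simp add: dist_norm norm_minus_commute)
    then show ?thesis using \<delta>(2) by blast
  qed
  then show ?thesis using that[of "c * \<delta>"] c(1) \<delta>(1) by (auto simp: norm_ball_def)
qed

lemma closed_segment_in_norm_ball:
  assumes "y \<in> norm_ball N \<rho> z"
  shows "closed_segment z y \<subseteq> norm_ball N \<rho> z"
proof
  fix w
  assume "w \<in> closed_segment z y"
  then obtain t where t: "0 \<le> t" "t \<le> 1" "w = (1 - t) *\<^sub>R z + t *\<^sub>R y"
    by (auto simp: closed_segment_def)
  then have "w - z = t *\<^sub>R (y - z)" by (simp add: algebra_simps)
  then have "N (w - z) = t * N (y - z)" using t by (simp add: vector_norm_scaleR)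
  also have "\<dots> \<le> N (y - z)" using t vector_norm_nonneg by (simp add: mult_left_le_one_le)
  finally show "w \<in> norm_ball N \<rho> z" using assms by (simp add: norm_ball_def)
qed

text \<open>
  Before the stopping test holds, the constant part of the one-step bound is at most
  \<open>(1 - \<theta>\<^sub>m\<^sub>a\<^sub>x) N (x i - z)\<close>, which is what the contraction by \<open>\<theta>\<^sub>m\<^sub>a\<^sub>x\<close> gains.
\<close>

lemma iterates_stay_in_norm_ball:
  assumes step: "\<And>i. x i \<in> norm_ball N \<rho> z \<Longrightarrow>
      N (x (Suc i) - z) \<le> a i * (N (x i - z))\<^sup>2 + b i * N (x i - z) + c i"
    and contr: "\<And>i. x i \<in> norm_ball N \<rho> z \<Longrightarrow> a i * N (x i - z) + b i < \<theta>max"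
    and \<theta>max: "\<theta>max < 1"
    and start: "x 0 \<in> norm_ball N \<rho> z"
    and running: "\<And>i. i < k \<Longrightarrow> \<not> N (x i - z) < c i / (1 - \<theta>max)"
  shows "x k \<in> norm_ball N \<rho> z"
  using running
proof (induction k)
  case 0
  show ?case by (rule start)
next
  case (Suc k)
  then have IH: "x k \<in> norm_ball N \<rho> z" by simp
  have "(a k * N (x k - z) + b k) * N (x k - z) \<le> \<theta>max * N (x k - z)"
    by (intro mult_right_mono less_imp_le[OF contr[OF IH]] vector_norm_nonneg)
  moreover have "c k \<le> (1 - \<theta>max) * N (x k - z)"
    using Suc.prems[of k] \<theta>max by (simp add: field_simps not_less)
  ultimately have "N (x (Suc k) - z) \<le> N (x k - z)"
    using step[OF IH] by (simp add: power2_eq_square algebra_simps)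
  then show ?case using IH by (simp add: norm_ball_def)
qed

end

lemma gradient_zero_at_local_minimizer:
  assumes grad: "GDERIV f z :> g" and min: "local_minimizer f z"
  shows "g = 0"
proof -
  obtain S where S: "open S" "z \<in> S" "\<forall>y\<in>S. f z \<le> f y"
    using min unfolding local_minimizer_def eventually_nhds by blast
  then have "(\<lambda>h. h \<bullet> g) = (\<lambda>h. 0)"
    using differential_zero_maxmin[OF S(2,1) grad[unfolded gderiv_def]] by blast
  then show ?thesis by (metis inner_eq_zero_iff)
qed

theorem theorem2p3:
  fixes N :: "real ^ 'n \<Rightarrow> real"
    and f :: "real ^ 'n \<Rightarrow> real"
    and g :: "real ^ 'n \<Rightarrow> real ^ 'n"
    and H :: "real ^ 'n \<Rightarrow> real ^ 'n ^ 'n"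
    and xstar :: "real ^ 'n"
    and \<Omega> :: "(real ^ 'n) set"
    and L :: real
  assumes "vector_norm N"
    and "C2_with_gradient_hessian f g H"
    and "local_minimizer f xstar"
    and "invertible (H xstar)"
    and "open \<Omega>" and "xstar \<in> \<Omega>"
    and "lipschitz_matrix_fun N L \<Omega> H"
  shows
    "(\<forall>\<epsilon>g \<epsilon>H \<epsilon> eg EH ep d x i.
        mixed_precision_newton N g H \<epsilon>g \<epsilon>H \<epsilon> eg EH ep d x \<and>
        invertible (H (x i)) \<and> nu N (\<epsilon>H i) (H (x i)) < 1 \<longrightarrow>
        invertible (H (x i) + EH i) \<and>
        (closed_segment xstar (x i) \<subseteq> \<Omega> \<longrightarrow>
          N (x (Suc i) - xstar)
            \<le> alpha N L (\<epsilon>H i) (\<epsilon> i) (H (x i)) * (N (x i - xstar))\<^sup>2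
              + beta N (\<epsilon>H i) (\<epsilon> i) (H (x i)) * N (x i - xstar)
              + gamma N xstar (\<epsilon>g i) (\<epsilon>H i) (\<epsilon> i) (H (x i))))
     \<and>
     (\<forall>\<theta>max. 0 \<le> \<theta>max \<and> \<theta>max < 1 \<longrightarrow>
       (\<exists>\<rho>>0. \<forall>\<epsilon>g \<epsilon>H \<epsilon> eg EH ep d x.
          mixed_precision_newton N g H \<epsilon>g \<epsilon>H \<epsilon> eg EH ep d x \<and>
          (\<forall>i. invertible (H (x i)) \<longrightarrow>
               nu N (\<epsilon>H i) (H (x i)) < 1 \<and>
               theta N L xstar (\<epsilon>H i) (\<epsilon> i) (H (x i)) (x i) < \<theta>max) \<and>
          x 0 \<in> norm_ball N \<rho> xstar \<longrightarrow>
          (\<forall>k. (\<forall>i<k. \<not> N (x i - xstar)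
                         < gamma N xstar (\<epsilon>g i) (\<epsilon>H i) (\<epsilon> i) (H (x i)) / (1 - \<theta>max)) \<longrightarrow>
               invertible (H (x k)) \<and>
               invertible (H (x k) + EH k) \<and>
               N (x (Suc k) - xstar)
                 \<le> alpha N L (\<epsilon>H k) (\<epsilon> k) (H (x k)) * (N (x k - xstar))\<^sup>2
                   + beta N (\<epsilon>H k) (\<epsilon> k) (H (x k)) * N (x k - xstar)
                   + gamma N xstar (\<epsilon>g k) (\<epsilon>H k) (\<epsilon> k) (H (x k)))))"
proof (intro conjI)
  have der: "\<And>x. (g has_derivative (\<lambda>h. H x *v h)) (at x)"
    and grad: "GDERIV f xstar :> g xstar" and cont: "continuous_on UNIV H"
    using assms(2) by (auto simp: C2_with_gradient_hessian_def)
  note crit = gradient_zero_at_local_minimizer[OF grad assms(3)]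
  note invertible = mixed_precision_newton_invertible[OF assms(1)]
  note step = mixed_precision_newton_step[OF assms(1) der assms(7) crit]
  show "\<forall>\<epsilon>g \<epsilon>H \<epsilon> eg EH ep d x i.
      mixed_precision_newton N g H \<epsilon>g \<epsilon>H \<epsilon> eg EH ep d x \<and>
      invertible (H (x i)) \<and> nu N (\<epsilon>H i) (H (x i)) < 1 \<longrightarrow>
      invertible (H (x i) + EH i) \<and>
      (closed_segment xstar (x i) \<subseteq> \<Omega> \<longrightarrow>
        N (x (Suc i) - xstar)
          \<le> alpha N L (\<epsilon>H i) (\<epsilon> i) (H (x i)) * (N (x i - xstar))\<^sup>2
            + beta N (\<epsilon>H i) (\<epsilon> i) (H (x i)) * N (x i - xstar)
            + gamma N xstar (\<epsilon>g i) (\<epsilon>H i) (\<epsilon> i) (H (x i)))"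
    by (intro allI impI conjI; elim conjE) (rule invertible step; assumption)+
  have "open (\<Omega> \<inter> {y. invertible (H y)})" "xstar \<in> \<Omega> \<inter> {y. invertible (H y)}"
    using open_invertible[OF cont] assms(4-6) by auto
  then obtain \<rho> where \<rho>: "0 < \<rho>" "norm_ball N \<rho> xstar \<subseteq> \<Omega> \<inter> {y. invertible (H y)}"
    using norm_ball_in_open[OF assms(1)] by blast
  show "\<forall>\<theta>max. 0 \<le> \<theta>max \<and> \<theta>max < 1 \<longrightarrow>
       (\<exists>\<rho>>0. \<forall>\<epsilon>g \<epsilon>H \<epsilon> eg EH ep d x.
          mixed_precision_newton N g H \<epsilon>g \<epsilon>H \<epsilon> eg EH ep d x \<and>
          (\<forall>i. invertible (H (x i)) \<longrightarrow>
               nu N (\<epsilon>H i) (H (x i)) < 1 \<and>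
               theta N L xstar (\<epsilon>H i) (\<epsilon> i) (H (x i)) (x i) < \<theta>max) \<and>
          x 0 \<in> norm_ball N \<rho> xstar \<longrightarrow>
          (\<forall>k. (\<forall>i<k. \<not> N (x i - xstar)
                         < gamma N xstar (\<epsilon>g i) (\<epsilon>H i) (\<epsilon> i) (H (x i)) / (1 - \<theta>max)) \<longrightarrow>
               invertible (H (x k)) \<and>
               invertible (H (x k) + EH k) \<and>
               N (x (Suc k) - xstar)
                 \<le> alpha N L (\<epsilon>H k) (\<epsilon> k) (H (x k)) * (N (x k - xstar))\<^sup>2
                   + beta N (\<epsilon>H k) (\<epsilon> k) (H (x k)) * N (x k - xstar)
                   + gamma N xstar (\<epsilon>g k) (\<epsilon>H k) (\<epsilon> k) (H (x k))))"
  proof (intro allI impI exI[of _ \<rho>] conjI \<rho>(1); elim conjE)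
    fix \<theta>max :: real and \<epsilon>g \<epsilon>H \<epsilon> eg EH ep d x k
    assume \<theta>max: "\<theta>max < 1"
      and newton: "mixed_precision_newton N g H \<epsilon>g \<epsilon>H \<epsilon> eg EH ep d x"
      and small: "\<forall>i. invertible (H (x i)) \<longrightarrow>
        nu N (\<epsilon>H i) (H (x i)) < 1 \<and> theta N L xstar (\<epsilon>H i) (\<epsilon> i) (H (x i)) (x i) < \<theta>max"
      and start: "x 0 \<in> norm_ball N \<rho> xstar"
      and running: "\<forall>i<k. \<not> N (x i - xstar)
        < gamma N xstar (\<epsilon>g i) (\<epsilon>H i) (\<epsilon> i) (H (x i)) / (1 - \<theta>max)"
    have inv: "invertible (H (x i))" and \<nu>: "nu N (\<epsilon>H i) (H (x i)) < 1"
      and contr: "alpha N L (\<epsilon>H i) (\<epsilon> i) (H (x i)) * N (x i - xstar)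
        + beta N (\<epsilon>H i) (\<epsilon> i) (H (x i)) < \<theta>max"
      and bound: "N (x (Suc i) - xstar)
        \<le> alpha N L (\<epsilon>H i) (\<epsilon> i) (H (x i)) * (N (x i - xstar))\<^sup>2
          + beta N (\<epsilon>H i) (\<epsilon> i) (H (x i)) * N (x i - xstar)
          + gamma N xstar (\<epsilon>g i) (\<epsilon>H i) (\<epsilon> i) (H (x i))"
      if "x i \<in> norm_ball N \<rho> xstar" for i
    proof -
      show inv: "invertible (H (x i))" using that \<rho>(2) by blast
      then show \<nu>: "nu N (\<epsilon>H i) (H (x i)) < 1"
        and "alpha N L (\<epsilon>H i) (\<epsilon> i) (H (x i)) * N (x i - xstar)
          + beta N (\<epsilon>H i) (\<epsilon> i) (H (x i)) < \<theta>max"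
        using small by (auto simp: theta_def)
      have "closed_segment xstar (x i) \<subseteq> \<Omega>"
        using closed_segment_in_norm_ball[OF assms(1) that] \<rho>(2) by blast
      then show "N (x (Suc i) - xstar)
        \<le> alpha N L (\<epsilon>H i) (\<epsilon> i) (H (x i)) * (N (x i - xstar))\<^sup>2
          + beta N (\<epsilon>H i) (\<epsilon> i) (H (x i)) * N (x i - xstar)
          + gamma N xstar (\<epsilon>g i) (\<epsilon>H i) (\<epsilon> i) (H (x i))"
        by (rule step[OF newton inv \<nu>])
    qed
    have ball: "x k \<in> norm_ball N \<rho> xstar"
      by (rule iterates_stay_in_norm_ball[OF assms(1) bound contr \<theta>max start])
        (use running in auto)
    show "invertible (H (x k))" by (rule inv[OF ball])
    show "invertible (H (x k) + EH k)"
      by (rule invertible[OF newton inv[OF ball] \<nu>[OF ball]])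
    show "N (x (Suc k) - xstar)
        \<le> alpha N L (\<epsilon>H k) (\<epsilon> k) (H (x k)) * (N (x k - xstar))\<^sup>2
          + beta N (\<epsilon>H k) (\<epsilon> k) (H (x k)) * N (x k - xstar)
          + gamma N xstar (\<epsilon>g k) (\<epsilon>H k) (\<epsilon> k) (H (x k))"
      by (rule bound[OF ball])
  qed
qed

end
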